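(* For every positive integer $N$, \[ \sum_{\substack{\pi\in\mathcal{P}_{3,4}\\ |\pi|=N}} (-1)^{\nu(\pi)} = \begin{cases} 1, & \text{if $N$ is even and $(2j)^2<N<(2j+1)^2$ for some integer $j\ge 1$},\\ -1, & \text{if $N$ is odd and $(2j-1)^2<N<(2j)^2$ for some integer $j\ge 1$},\\ 0, & \text{otherwise.} \end{cases} \]
   Context: A partition is a finite non-increasing sequence of positive integers (its parts); $|\pi|$ is the sum of its parts and $\nu(\pi)$ the number of parts counted with multiplicity. $\mathcal{P}_{3,4}$ is the set of non-empty partitions in which every even part size occurs at most once (odd parts may repeat) and whose smallest part is congruent to $3$ modulo $4$. *)

theory Defs
  imports Main
begin

definition is_partition :: "nat list \<Rightarrow> bool" where
  "is_partition p \<longleftrightarrow> sorted_wrt (\<ge>) p \<and> (\<forall>x \<in> set p. 0 < x)"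

abbreviation weight :: "nat list \<Rightarrow> nat" where
  "weight p \<equiv> sum_list p"

abbreviation num_parts :: "nat list \<Rightarrow> nat" where
  "num_parts p \<equiv> length p"

definition P34 :: "nat list set" where
  "P34 = {p. is_partition p \<and> p \<noteq> []
             \<and> (\<forall>m. even m \<longrightarrow> count_list p m \<le> 1)
             \<and> Min (set p) mod 4 = 3}"

text \<open>The sum over the partitions of \<open>N\<close> in \<open>P34\<close> is thus a genuine finite sum.\<close>

lemma finite_P34_weight: "finite {p \<in> P34. weight p = N}"
proof (rule finite_subset)
  have "length p \<le> sum_list p" if "\<forall>x \<in> set p. 0 < x" for p :: "nat list"
    using that by (induction p) auto
  then show "{p \<in> P34. weight p = N} \<subseteq> {p. set p \<subseteq> {..N} \<and> length p \<le> N}"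
    by (auto simp: P34_def is_partition_def dest: member_le_sum_list)
  show "finite {p. set p \<subseteq> {..N} \<and> length p \<le> N}"
    by (rule finite_lists_length_le) simp
qed

end

(* Let A(s) be the generating function of partitions with parts >= s and distinct even parts, weighted
   by (-1)^(number of parts), and put B(m) = A(2m+1). Removing the smallest part gives
   (1 + q^(2m+1)) B(m) = (1 - q^(2m+2)) B(m+1), and the signed count of P34 is - sum over odd m of
   q^(2m+1) B(m), i.e. half of q (sum (-1)^m q^(2m) B(m) - sum q^(2m) B(m)).
   The second sum telescopes to 1/(1+q). The first is the value at z = -q^2 of f(z) = sum z^m B(m),
   whose functional equation (1-z) f(z) = (1+qz) f(q^2 z) turns it into an infinite product; by
   Gauss' identity prod (1-q^i)/(1+q^i) = 1 + 2 sum (-1)^j q^(j^2) it equals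
   (1 + 2 sum (-1)^j q^(j^2)) / (1-q), whose k-th coefficient is (-1)^floor(sqrt k). *)

theory Submission
  imports Defs "HOL-Computational_Algebra.Formal_Power_Series" "HOL-Library.Discrete_Functions"
begin

section \<open>A finite form of Gauss' theta identity\<close>

text \<open>A division-free analogue for squares of Shanks' finite form of Gauss' triangular number
  identity. The summands \<open>u (Suc n) s - (1 + q^Suc n) * u n s\<close> telescope in \<open>s\<close>.\<close>

lemma finite_gauss:
  fixes q :: "'a :: comm_ring_1"
  defines "u \<equiv> \<lambda>n s. (-1)^s * q^(s * Suc n) * (\<Prod>i\<in>{s<..n}. 1 - q^i) * (\<Prod>i=1..<s. 1 + q^i)"
  shows "(1 + 2 * (\<Sum>j=1..n. (-1)^j * q^(j^2))) * (\<Prod>i=1..n. 1 + q^i)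
       = (\<Prod>i=1..n. 1 - q^i) + 2 * (\<Sum>s=1..n. u n s)"
proof (induction n)
  case (Suc n)
  define C where "C = (\<lambda>s. \<Prod>i\<in>{s<..n}. 1 - q^i)"
  define D where "D = (\<lambda>s. \<Prod>i=1..<s. 1 + q^i)"
  define P where "P = (\<Prod>i=1..n. 1 + q^i)"
  define M where "M = (\<Prod>i=1..n. 1 - q^i)"
  \<comment> \<open>Telescoping certificate: \<open>u (Suc n) s\<close> and \<open>u n s\<close>
    share the factor (-1)^s q^(s(n+1)) C(s) D(s), and the remaining q^s (1 - q^(n+1)) - (1 +
    q^(n+1)) regroups as -q^(n+1) (1 + q^s) - (1 - q^s).\<close>
  define V where "V = (\<lambda>s. (-1)^s * q^(Suc n * s) * C (s - 1) * D s)"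
  have step: "u (Suc n) s - (1 + q^Suc n) * u n s = V (Suc s) - V s" if "s \<in> {1..<Suc n}" for s
  proof -
    have "{s<..Suc n} = insert (Suc n) {s<..n}" "{s - 1<..n} = insert s {s<..n}"
      using that by auto
    then have C1: "(\<Prod>i\<in>{s<..Suc n}. 1 - q^i) = (1 - q^Suc n) * C s"
      and C2: "C (s - 1) = (1 - q^s) * C s"
      by (simp_all add: C_def)
    have D: "D (Suc s) = D s * (1 + q^s)"
      using that by (simp add: D_def)
    have u: "u (Suc n) s = (-1)^s * q^(s * Suc (Suc n)) * ((1 - q^Suc n) * C s) * D s"
      "u n s = (-1)^s * q^(s * Suc n) * C s * D s"
      by (simp_all only: u_def C1) (simp_all only: C_def D_def)
    show ?thesis
      unfolding u V_def C2 D diff_Suc_1 by (simp add: algebra_simps power_add)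
  qed
  have "(\<Sum>s=1..<Suc n. u (Suc n) s - (1 + q^Suc n) * u n s) = V (Suc n) - V 1"
    using step by (simp add: sum_Suc_diff' del: sum.op_ivl_Suc)
  moreover have "V (Suc n) = (-1)^Suc n * q^((Suc n)^2) * P"
    by (simp add: V_def C_def D_def P_def power2_eq_square atLeastLessThanSuc_atLeastAtMost)
  moreover have "V 1 = - (q^Suc n * M)"
  proof -
    have "{0<..n} = {1..n}" by auto
    then show ?thesis by (simp add: V_def C_def D_def M_def)
  qed
  \<comment> \<open>The telescoping stops at s = n; this last summand and \<open>V (Suc n)\<close>
    together give (1 + q^(n+1)) P times the new theta term.\<close>
  moreover have "u (Suc n) (Suc n) = (-1)^Suc n * q^((Suc n)^2) * q^Suc n * P"
    by (simp add: u_def P_def power2_eq_square atLeastLessThanSuc_atLeastAtMost algebra_simps power_add)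
  ultimately have sum_u: "(\<Sum>s=1..Suc n. u (Suc n) s) = (1 + q^Suc n) * (\<Sum>s=1..n. u n s)
      + q^Suc n * M + (1 + q^Suc n) * ((-1)^Suc n * q^((Suc n)^2) * P)"
    by (simp add: atLeastLessThanSuc_atLeastAtMost sum_subtractf sum_distrib_left algebra_simps)
  have prods: "(\<Prod>i=1..Suc n. 1 + q^i) = (1 + q^Suc n) * P" "(\<Prod>i=1..Suc n. 1 - q^i) = (1 - q^Suc n) * M"
    by (simp_all add: P_def M_def)
  define T where "T = (\<Sum>j=1..n. (-1)^j * q^(j^2))"
  define E where "E = (-1)^Suc n * q^((Suc n)^2)"
  have T: "(\<Sum>j=1..Suc n. (-1)^j * q^(j^2)) = T + E"
    by (simp add: T_def E_def)
  have "(1 + 2 * (T + E)) * ((1 + q^Suc n) * P) =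
      (1 + q^Suc n) * ((1 + 2 * T) * P) + 2 * ((1 + q^Suc n) * (E * P))"
    by (simp add: algebra_simps)
  also have "(1 + 2 * T) * P = M + 2 * (\<Sum>s=1..n. u n s)"
    using Suc.IH by (simp add: T_def P_def M_def)
  finally show ?case
    unfolding T prods sum_u E_def [symmetric] by (simp add: algebra_simps)
qed simp

section \<open>Congruences between power series modulo a power of the variable\<close>

text \<open>Divisibility by \<open>fps_X^k\<close> serves as congruence modulo q^k below, so that
  finite products can stand in for infinite ones.\<close>

lemma fps_X_power_dvd_iff: "fps_X^k dvd (f :: 'a :: comm_ring_1 fps) \<longleftrightarrow> (\<forall>n<k. fps_nth f n = 0)"
proof
  assume "\<forall>n<k. fps_nth f n = 0"
  then have "f = fps_X^k * fps_shift k f"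
    by (intro fps_ext) (auto simp: fps_X_power_mult_nth)
  then show "fps_X^k dvd f" by (metis dvd_triv_left)
qed (auto simp: fps_X_power_mult_nth)

text \<open>A series with constant term 1 is a unit.\<close>

lemma fps_X_power_dvd_cancel:
  fixes f g :: "'a :: comm_ring_1 fps"
  assumes "fps_X^k dvd f * g" and "fps_nth g 0 = 1"
  shows "fps_X^k dvd f"
proof -
  have "g * fps_right_inverse g 1 = 1"
    using assms(2) by (intro fps_right_inverse) simp
  then have "f = (f * g) * fps_right_inverse g 1"
    by (simp add: mult.assoc)
  with assms(1) show ?thesis by (metis dvd_mult2)
qed

lemma fps_prod_nth_0: "fps_nth (\<Prod>i\<in>I. f i) 0 = (\<Prod>i\<in>I. fps_nth (f i) 0)"
  for f :: "'b \<Rightarrow> 'a :: comm_ring_1 fps"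
  by (induction I rule: infinite_finite_induct) simp_all

text \<open>Truncation of the sum of (-1)^j q^(j^2) over all integers j, with j and -j
  paired.\<close>

definition theta :: "nat \<Rightarrow> int fps" where
  "theta n = 1 + 2 * (\<Sum>j=1..n. (-1)^j * fps_X^(j^2))"

text \<open>In \<open>finite_gauss\<close> every correction term has s \<ge> 1 and hence the factor
  q^(s(n+1)).\<close>

lemma theta_cong:
  "fps_X^n dvd theta n * (\<Prod>i=1..n. 1 + fps_X^i) - (\<Prod>i=1..n. 1 - fps_X^i)"
proof -
  have "fps_X^n dvd (-1)^s * fps_X^(s * Suc n) * (\<Prod>i\<in>{s<..n}. 1 - fps_X^i) *
      (\<Prod>i=1..<s. 1 + fps_X^i :: int fps)" if "s \<in> {1..n}" for s
  proof -
    have "n \<le> s * Suc n" using that by (cases s) auto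
    then have "fps_X^n dvd (fps_X^(s * Suc n) :: int fps)" by (rule le_imp_power_dvd)
    then show ?thesis by (simp add: mult.assoc)
  qed
  then have "fps_X^n dvd (\<Sum>s=1..n. (-1)^s * fps_X^(s * Suc n) * (\<Prod>i\<in>{s<..n}. 1 - fps_X^i) *
      (\<Prod>i=1..<s. 1 + fps_X^i :: int fps))"
    by (rule dvd_sum)
  then show ?thesis
    unfolding theta_def finite_gauss add_diff_cancel_left' by (rule dvd_mult)
qed

lemma theta_nth:
  assumes "k \<le> n"
  shows "fps_nth (theta n) k = (if k = 0 then 1 else if \<exists>j. k = j^2 then 2 * (-1)^floor_sqrt k else 0)"
proof -
  have minus_one: "fps_nth ((-1)^j * f) k = (-1)^j * fps_nth f k" for j and f :: "int fps"
    by (cases "even j") auto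
  have *: "fps_nth (theta n) k =
      (if k = 0 then 1 else 0) + 2 * (\<Sum>j=1..n. if k = j^2 then (-1)^j else 0)"
  proof -
    have "fps_nth (\<Sum>j=1..n. (-1)^j * fps_X^(j^2) :: int fps) k = (\<Sum>j=1..n. if k = j^2 then (-1)^j else 0)"
      unfolding fps_sum_nth minus_one by (auto simp: fps_X_power_nth intro!: sum.cong)
    then show ?thesis by (simp only: theta_def mult_2 fps_add_nth fps_one_nth)
  qed
  show ?thesis
  proof (cases "k \<noteq> 0 \<and> (\<exists>j. k = j^2)")
    case True
    then obtain i where i: "k = i^2" by blast
    with True have "i \<noteq> 0" by auto
    moreover from this have "i \<le> n"
      using assms i self_le_power[of i 2] by simp
    moreover have "k = j^2 \<longleftrightarrow> j = i" for j
      using i by auto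
    ultimately have "(\<Sum>j=1..n. if k = j^2 then (-1 :: int)^j else 0) = (-1)^i"
      by (simp add: sum.delta)
    moreover have "floor_sqrt k = i" using i by simp
    ultimately show ?thesis
      using * True by simp
  next
    case False
    then show ?thesis
      unfolding * by (auto intro!: sum.neutral)
  qed
qed

section \<open>Signed generating functions of partitions with distinct even parts\<close>

text \<open>The empty partition is allowed, unlike in \<open>P34\<close>, since it may remain once
  the smallest part is removed.\<close>

definition admissible :: "nat \<Rightarrow> nat \<Rightarrow> nat list set" where
  "admissible s n = {p. sorted_wrt (\<ge>) p \<and> (\<forall>x\<in>set p. s \<le> x) \<and>
     (\<forall>m. even m \<longrightarrow> count_list p m \<le> 1) \<and> sum_list p = n}"

lemma finite_admissible:
  assumes "0 < s"
  shows "finite (admissible s n)"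
proof (rule finite_subset)
  have "length p \<le> sum_list p" if "\<forall>x\<in>set p. s \<le> x" for p
    using that assms by (induction p) auto
  then show "admissible s n \<subseteq> {p. set p \<subseteq> {..n} \<and> length p \<le> n}"
    by (auto simp: admissible_def dest: member_le_sum_list)
  show "finite {p. set p \<subseteq> {..n} \<and> length p \<le> n}"
    by (rule finite_lists_length_le) simp
qed

text \<open>After one copy of s is removed, an odd s may still occur, whereas an even s may not;
  hence the two lower bounds. The guard \<open>s \<le> n\<close> protects the truncated
  subtraction.\<close>

lemma append_smallest_admissible:
  "{p @ [s] |p. p @ [s] \<in> admissible s n} =
     (if s \<le> n then (\<lambda>p. p @ [s]) ` admissible (if odd s then s else Suc s) (n - s) else {})"
proof -
  have "p @ [s] \<in> admissible s n \<longleftrightarrow> s \<le> n \<and> p \<in> admissible (if odd s then s else Suc s) (n - s)" for p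
  proof (cases "odd s")
    case True
    then show ?thesis
      by (auto simp: admissible_def sorted_wrt_append)
  next
    case False
    have "count_list p s = 0 \<longleftrightarrow> s \<notin> set p" by (simp add: count_list_0_iff)
    moreover have "(\<forall>x\<in>set p. Suc s \<le> x) \<longleftrightarrow> (\<forall>x\<in>set p. s \<le> x) \<and> s \<notin> set p"
      by (auto simp: Suc_le_eq order_le_less)
    ultimately show ?thesis
      using False by (auto simp: admissible_def sorted_wrt_append)
  qed
  then show ?thesis by auto
qed

text \<open>If s occurs at all, it is the smallest part and so the last entry.\<close>

lemma admissible_split:
  "admissible s n = admissible (Suc s) n \<union> {p @ [s] |p. p @ [s] \<in> admissible s n}"
proof -
  have "\<exists>p'. p = p' @ [s]" if "p \<in> admissible s n" "p \<notin> admissible (Suc s) n" for p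
  proof -
    from that have "s \<in> set p"
      by (auto simp: admissible_def not_less_eq_eq)
    then show ?thesis
    proof (cases p rule: rev_cases)
      case (snoc p' y)
      with that \<open>s \<in> set p\<close> have "y = s"
        by (auto simp: admissible_def sorted_wrt_append intro: le_antisym)
      with snoc show ?thesis by blast
    qed simp
  qed
  moreover have "admissible (Suc s) n \<subseteq> admissible s n"
    by (auto simp: admissible_def dest: Suc_leD)
  ultimately show ?thesis by blast
qed

definition signed_gf :: "nat \<Rightarrow> int fps" where
  "signed_gf s = Abs_fps (\<lambda>n. \<Sum>p\<in>admissible s n. (-1)^length p)"

lemma sum_append_smallest:
  "(\<Sum>p\<in>{p @ [s] |p. p @ [s] \<in> admissible s n}. (-1 :: int)^length p) =
     - fps_nth (fps_X^s * signed_gf (if odd s then s else Suc s)) n"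
  by (simp add: append_smallest_admissible fps_X_power_mult_nth signed_gf_def sum_negf
      sum.reindex inj_on_def)

lemma signed_gf_rec:
  assumes "0 < s"
  shows "signed_gf s = signed_gf (Suc s) - fps_X^s * signed_gf (if odd s then s else Suc s)"
proof (rule fps_ext)
  fix n
  have fin: "finite (admissible s n)"
    using assms by (rule finite_admissible)
  have "fps_nth (signed_gf s) n = (\<Sum>p\<in>admissible (Suc s) n \<union>
      {p @ [s] |p. p @ [s] \<in> admissible s n}. (-1)^length p)"
    unfolding signed_gf_def fps_nth_Abs_fps by (rule sum.cong[OF admissible_split refl])
  also have "\<dots> = (\<Sum>p\<in>admissible (Suc s) n. (-1)^length p) +
      (\<Sum>p\<in>{p @ [s] |p. p @ [s] \<in> admissible s n}. (-1)^length p)"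
  proof (rule sum.union_disjoint)
    show "finite {p @ [s] |p. p @ [s] \<in> admissible s n}"
      by (rule finite_subset[OF _ fin]) blast
    show "finite (admissible (Suc s) n)"
      by (simp add: finite_admissible)
    show "admissible (Suc s) n \<inter> {p @ [s] |p. p @ [s] \<in> admissible s n} = {}"
    proof -
      have "p @ [s] \<notin> admissible (Suc s) n" for p
        by (simp add: admissible_def)
      then show ?thesis by blast
    qed
  qed
  finally show "fps_nth (signed_gf s) n =
      fps_nth (signed_gf (Suc s) - fps_X^s * signed_gf (if odd s then s else Suc s)) n"
    unfolding sum_append_smallest fps_sub_nth by (simp only: signed_gf_def fps_nth_Abs_fps add_uminus_conv_diff)
qed

text \<open>Only the empty partition has weight below s.\<close>

lemma signed_gf_cong: "fps_X^s dvd signed_gf s - 1"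
  unfolding fps_X_power_dvd_iff
proof (intro allI impI)
  fix n assume "n < s"
  have "admissible s n \<subseteq> {[]}"
  proof
    fix p assume p: "p \<in> admissible s n"
    show "p \<in> {[]}"
    proof (cases p)
      case (Cons a q)
      with p have "s \<le> a" "a + sum_list q = n"
        unfolding admissible_def by simp_all
      with \<open>n < s\<close> show ?thesis by linarith
    qed simp
  qed
  moreover have "[] \<in> admissible s n \<longleftrightarrow> n = 0"
    by (auto simp: admissible_def)
  ultimately have "admissible s n = (if n = 0 then {[]} else {})"
    by (auto simp: subset_singleton_iff)
  then show "fps_nth (signed_gf s - 1) n = 0"
    by (simp add: signed_gf_def)
qed

section \<open>The series B(m): recurrence and product formula\<close>

definition odd_gf :: "nat \<Rightarrow> int fps" where
  "odd_gf m = signed_gf (2 * m + 1)"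

lemma odd_gf_rec: "(1 + fps_X^(2*m+1)) * odd_gf m = (1 - fps_X^(2*m+2)) * odd_gf (Suc m)"
proof -
  have "signed_gf (2*m+1) = signed_gf (2*m+2) - fps_X^(2*m+1) * signed_gf (2*m+1)"
    using signed_gf_rec[of "2*m+1"] by (simp del: power_Suc)
  then have "(1 + fps_X^(2*m+1)) * signed_gf (2*m+1) = signed_gf (2*m+2)"
    by (simp only: eq_diff_eq distrib_right mult_1)
  also have "\<dots> = (1 - fps_X^(2*m+2)) * signed_gf (2 * Suc m + 1)"
    using signed_gf_rec[of "2*m+2"] by (simp add: left_diff_distrib del: power_Suc)
  finally show ?thesis by (simp only: odd_gf_def)
qed

lemma odd_gf_cong: "fps_X^(2*m) dvd odd_gf m - 1"
  using signed_gf_cong[of "2*m+1"] power_le_dvd[of fps_X "2*m+1" _ "2*m"] by (simp add: odd_gf_def)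

lemma odd_gf_prod: "(\<Prod>i<m. 1 + fps_X^(2*i+1)) * odd_gf 0 = (\<Prod>i<m. 1 - fps_X^(2*i+2)) * odd_gf m"
proof (induction m)
  case (Suc m)
  have "(\<Prod>i<Suc m. 1 + fps_X^(2*i+1)) * odd_gf 0 =
      (1 + fps_X^(2*m+1)) * ((\<Prod>i<m. 1 + fps_X^(2*i+1)) * odd_gf 0)"
    by (simp add: algebra_simps)
  also have "\<dots> = (\<Prod>i<m. 1 - fps_X^(2*i+2)) * ((1 + fps_X^(2*m+1)) * odd_gf m)"
    unfolding Suc.IH by (simp add: algebra_simps)
  finally show ?case
    unfolding odd_gf_rec by (simp add: algebra_simps)
qed simp

section \<open>Weighted sums of the B(m)\<close>

text \<open>The first k terms of f(z) at z = -q^(2i); replacing z by q^2 z means replacing i by i +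
  1.\<close>

definition alt_sum :: "nat \<Rightarrow> nat \<Rightarrow> int fps" where
  "alt_sum k i = (\<Sum>m<k. (- (fps_X^(2*i)))^m * odd_gf m)"

text \<open>By \<open>odd_gf_rec\<close>, the right-hand side grows by (1 + q) q^(2k) B(k) from k to
  k + 1.\<close>

lemma sum_odd_gf: "(1 + fps_X) * (\<Sum>m<k. fps_X^(2*m) * odd_gf m) = (1 - fps_X^(2*k)) * odd_gf k"
proof (induction k)
  case (Suc k)
  have "(1 + fps_X) * (\<Sum>m<Suc k. fps_X^(2*m) * odd_gf m) =
      (1 - fps_X^(2*k)) * odd_gf k + (1 + fps_X) * (fps_X^(2*k) * odd_gf k)"
    using Suc.IH by (simp add: algebra_simps)
  also have "\<dots> = (1 + fps_X^(2*k+1)) * odd_gf k"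
    by (simp add: algebra_simps)
  finally show ?case
    unfolding odd_gf_rec by simp
qed simp

text \<open>The functional equation (1 - z) f(z) = (1 + qz) f(q^2 z) at z = -q^(2i), with the exact
  boundary term left by truncation.\<close>

lemma alt_sum_rec:
  "(1 + fps_X^(2*i)) * alt_sum k i - (1 - fps_X^(2*i+1)) * alt_sum k (Suc i) =
     - ((- (fps_X^(2*i)))^k * (1 - fps_X^(2*k)) * odd_gf k)"
proof (induction k)
  case (Suc k)
  define z :: "int fps" where "z = - (fps_X^(2*i))"
  have z: "(- (fps_X^(2 * Suc i)))^k = z^k * fps_X^(2*k)"
    by (simp add: z_def power_mult_distrib[symmetric] power_mult power2_eq_square)
       (simp add: algebra_simps)
  have "(1 + fps_X^(2*i)) * alt_sum (Suc k) i - (1 - fps_X^(2*i+1)) * alt_sum (Suc k) (Suc i) =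
      - (z^k * (1 - fps_X^(2*k)) * odd_gf k) + (1 - z) * (z^k * odd_gf k) -
        (1 + fps_X * z) * (z^k * fps_X^(2*k) * odd_gf k)"
    using Suc.IH unfolding alt_sum_def sum.lessThan_Suc z
    by (simp add: z_def algebra_simps)
  also have "\<dots> = - (z^Suc k * ((1 + fps_X^(2*k+1)) * odd_gf k))"
    by (simp add: algebra_simps)
  finally show ?case
    unfolding odd_gf_rec z_def by (simp add: algebra_simps)
qed (simp add: alt_sum_def)


text \<open>For i > 0 the boundary term contains z^k, of order 2ik \<ge> k.\<close>

lemma alt_sum_rec_cong:
  assumes "0 < i"
  shows "fps_X^k dvd (1 + fps_X^(2*i)) * alt_sum k i - (1 - fps_X^(2*i+1)) * alt_sum k (Suc i)"
proof -
  have "fps_X^k dvd (fps_X^(2*i*k) :: int fps)"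
    using assms by (intro le_imp_power_dvd) simp
  then have "fps_X^k dvd (- (fps_X^(2*i)) :: int fps)^k"
    by (subst power_minus) (simp add: power_mult)
  then show ?thesis
    unfolding alt_sum_rec by (simp add: mult.assoc)
qed

lemma alt_sum_prod_cong:
  "fps_X^k dvd (\<Prod>i<l. 1 + fps_X^(2*i+2)) * alt_sum k 1 - (\<Prod>i<l. 1 - fps_X^(2*i+3)) * alt_sum k (Suc l)"
proof (induction l)
  case (Suc l)
  let ?P = "\<Prod>i<l. 1 + fps_X^(2*i+2) :: int fps" and ?M = "\<Prod>i<l. 1 - fps_X^(2*i+3) :: int fps"
  have "fps_X^k dvd (1 + fps_X^(2*l+2)) * alt_sum k (Suc l) - (1 - fps_X^(2*l+3)) * alt_sum k (Suc (Suc l))"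
    using alt_sum_rec_cong[of "Suc l" k] by (simp add: eval_nat_numeral)
  \<comment> \<open>Weights chosen so that the intermediate value y, here
    \<open>alt_sum k (Suc l)\<close>, cancels.\<close>
  moreover have combine: "a * (p * x - m * y) + m * (a * y - b * z) = p * a * x - m * b * z"
    for a b p m x y z :: "int fps"
    by (simp add: algebra_simps)
  ultimately have "fps_X^k dvd (1 + fps_X^(2*l+2)) * (?P * alt_sum k 1 - ?M * alt_sum k (Suc l)) +
      ?M * ((1 + fps_X^(2*l+2)) * alt_sum k (Suc l) - (1 - fps_X^(2*l+3)) * alt_sum k (Suc (Suc l)))"
    using Suc.IH by (intro dvd_add dvd_mult)
  then show ?case
    unfolding prod.lessThan_Suc combine .
qed simp

text \<open>Modulo z only the term m = 0 survives; it is present because k > 0.\<close>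

lemma alt_sum_cong:
  assumes "0 < k"
  shows "fps_X^(2*i) dvd alt_sum k i - odd_gf 0"
proof -
  obtain l where "k = Suc l" using assms by (cases k) auto
  then have "alt_sum k i - odd_gf 0 = (\<Sum>m<l. (- (fps_X^(2*i)))^Suc m * odd_gf (Suc m))"
    by (simp add: alt_sum_def sum.lessThan_Suc_shift del: power_Suc sum.lessThan_Suc)
  then show ?thesis
    by (auto intro!: dvd_sum)
qed

lemma prod_odd_even:
  fixes g :: "nat \<Rightarrow> 'a :: comm_monoid_mult"
  shows "(\<Prod>i=1..2*k. g i) = (\<Prod>i<k. g (2*i+1)) * (\<Prod>i<k. g (2*i+2))"
  by (induction k) (simp_all add: ac_simps)

text \<open>Modulo q^k, with f = \<open>alt_sum k 1\<close>: Pe f = Mo' B(0), Po B(0) = Me and (1 -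
  q) Mo' = Mo. Hence (1 - q) f Po Pe = Mo Me, which is \<open>theta (2*k)\<close> times Po Pe by
  Gauss, and Po Pe cancels.\<close>

lemma alt_sum_1_cong:
  assumes "0 < k"
  shows "fps_X^k dvd (1 - fps_X) * alt_sum k 1 - theta (2*k)"
proof -
  define Po Pe Mo Me Mo' :: "int fps" where
    "Po = (\<Prod>i<k. 1 + fps_X^(2*i+1))" and "Pe = (\<Prod>i<k. 1 + fps_X^(2*i+2))" and
    "Mo = (\<Prod>i<k. 1 - fps_X^(2*i+1))" and "Me = (\<Prod>i<k. 1 - fps_X^(2*i+2))" and
    "Mo' = (\<Prod>i<k. 1 - fps_X^(2*i+3))"
  have F1: "fps_X^k dvd Pe * alt_sum k 1 - Mo' * alt_sum k (Suc k)"
    unfolding Pe_def Mo'_def by (rule alt_sum_prod_cong)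
  have Fk: "fps_X^k dvd alt_sum k (Suc k) - odd_gf 0"
    using alt_sum_cong[OF assms, of "Suc k"] by (rule power_le_dvd) simp
  have "Po * odd_gf 0 - Me = Me * (odd_gf k - 1)"
    using odd_gf_prod[of k] by (simp add: Po_def Me_def algebra_simps)
  moreover have "fps_X^k dvd odd_gf k - 1"
    using odd_gf_cong[of k] by (rule power_le_dvd) simp
  ultimately have B0: "fps_X^k dvd Po * odd_gf 0 - Me"
    by simp
  \<comment> \<open>Mo' starts at exponent 3, so 1 - q supplies its missing first factor; the
    surplus last factor 1 - q^(2k+1) is 1 modulo q^k.\<close>
  have "(1 - fps_X) * Mo' = (\<Prod>i<Suc k. 1 - fps_X^(2*i+1))"
    unfolding prod.lessThan_Suc_shift by (simp add: Mo'_def eval_nat_numeral)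
  then have "(1 - fps_X) * Mo' - Mo = - (Mo * fps_X^(2*k+1))"
    by (simp add: Mo_def algebra_simps)
  moreover have "fps_X^k dvd (fps_X^(2*k+1) :: int fps)"
    by (rule le_imp_power_dvd) simp
  ultimately have M: "fps_X^k dvd (1 - fps_X) * Mo' - Mo"
    by simp
  have theta: "fps_X^k dvd theta (2*k) * (Po * Pe) - Mo * Me"
    using power_le_dvd[OF theta_cong[of "2*k"], of k]
    unfolding prod_odd_even Po_def Pe_def Mo_def Me_def by simp
  from F1 Fk B0 M have "fps_X^k dvd
      (1 - fps_X) * Po * (Pe * alt_sum k 1 - Mo' * alt_sum k (Suc k)) +
      (1 - fps_X) * Po * Mo' * (alt_sum k (Suc k) - odd_gf 0) +
      (1 - fps_X) * Mo' * (Po * odd_gf 0 - Me) + Me * ((1 - fps_X) * Mo' - Mo)"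
    by (intro dvd_add dvd_mult)
  from dvd_diff[OF this theta] have "fps_X^k dvd ((1 - fps_X) * alt_sum k 1 - theta (2*k)) * (Po * Pe)"
    by (simp add: algebra_simps)
  moreover have "fps_nth (Po * Pe) 0 = 1"
    by (simp add: Po_def Pe_def fps_prod_nth_0)
  ultimately show ?thesis
    by (rule fps_X_power_dvd_cancel)
qed

text \<open>Dividing by 1 - q takes partial sums of the theta coefficients: each square j^2 with j
  \<ge> 1 adds 2 (-1)^j and so flips (-1)^(j-1) to (-1)^j.\<close>

lemma alt_sum_1_nth:
  assumes "n < k"
  shows "fps_nth (alt_sum k 1) n = (-1)^floor_sqrt n"
  using assms
proof (induction n)
  case 0
  have "fps_nth ((1 - fps_X) * alt_sum k 1 - theta (2*k)) 0 = 0"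
    using alt_sum_1_cong[of k] 0 unfolding fps_X_power_dvd_iff by blast
  then show ?case using theta_nth[of 0 "2*k"] by simp
next
  case (Suc n)
  have "fps_nth ((1 - fps_X) * alt_sum k 1 - theta (2*k)) (Suc n) = 0"
    using alt_sum_1_cong[of k] Suc.prems unfolding fps_X_power_dvd_iff by auto
  then have "fps_nth (alt_sum k 1) (Suc n) = fps_nth (alt_sum k 1) n + fps_nth (theta (2*k)) (Suc n)"
    by (simp add: left_diff_distrib)
  with Suc show ?case
    using theta_nth[of "Suc n" "2*k"] by (simp add: floor_sqrt_Suc)
qed

text \<open>Modulo q^k the sum is 1/(1 + q), since B(k) is 1 there.\<close>

lemma sum_odd_gf_nth:
  assumes "n < k"
  shows "fps_nth (\<Sum>m<k. fps_X^(2*m) * odd_gf m) n = (-1)^n"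
proof -
  let ?S = "\<Sum>m<k. fps_X^(2*m) * odd_gf m"
  have "(1 + fps_X) * ?S - 1 = (odd_gf k - 1) - fps_X^(2*k) * odd_gf k"
    unfolding sum_odd_gf by (simp add: algebra_simps)
  also have "fps_X^(2*k) dvd \<dots>"
    using odd_gf_cong by (rule dvd_diff) simp
  finally have S: "fps_nth ((1 + fps_X) * ?S - 1) i = 0" if "i < k" for i
    unfolding fps_X_power_dvd_iff using that by simp
  show ?thesis using assms
  proof (induction n)
    case 0
    then show ?case using S[of 0] by (simp add: distrib_right)
  next
    case (Suc n)
    then show ?case using S[of "Suc n"] by (simp add: distrib_right)
  qed
qed

section \<open>Coefficients\<close>

text \<open>A smallest part congruent to 3 modulo 4 is 2m + 1 with m odd. The generous bound m < N
  matches the truncation of the sums above.\<close>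

lemma P34_decomp:
  "{p \<in> P34. sum_list p = N} =
     (\<Union>m\<in>{m. m < N \<and> odd m}. {p @ [2*m+1] |p. p @ [2*m+1] \<in> admissible (2*m+1) N})"
proof (intro equalityI subsetI)
  fix p assume p: "p \<in> {p \<in> P34. sum_list p = N}"
  then obtain p' s where p': "p = p' @ [s]"
    by (cases p rule: rev_cases) (auto simp: P34_def)
  have "Min (set p) = s"
    using p by (intro Min_eqI) (auto simp: p' P34_def is_partition_def sorted_wrt_append)
  with p have s: "s mod 4 = 3" by (simp add: P34_def)
  define m where "m = s div 2"
  have m: "s = 2*m+1" "odd m"
    unfolding m_def using s by presburger+
  have "s \<le> N" using p by (auto simp: p')
  with m have "m < N" by simp
  moreover have "p \<in> admissible s N"
    using p by (auto simp: p' P34_def is_partition_def admissible_def sorted_wrt_append)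
  ultimately show "p \<in> (\<Union>m\<in>{m. m < N \<and> odd m}. {p @ [2*m+1] |p. p @ [2*m+1] \<in> admissible (2*m+1) N})"
    using m p' by auto
next
  fix p assume "p \<in> (\<Union>m\<in>{m. m < N \<and> odd m}. {p @ [2*m+1] |p. p @ [2*m+1] \<in> admissible (2*m+1) N})"
  then obtain m p' where m: "odd m" and p: "p = p' @ [2*m+1]" "p \<in> admissible (2*m+1) N"
    by blast
  have "Min (set p) = 2*m+1"
    using p(2) by (intro Min_eqI) (auto simp: p(1) admissible_def)
  moreover have "(2*m+1) mod 4 = 3"
    using m by presburger
  ultimately show "p \<in> {p \<in> P34. sum_list p = N}"
    using p by (force simp: P34_def is_partition_def admissible_def)
qed

lemma P34_sum:
  assumes "N \<ge> 1"
  shows "2 * (\<Sum>p\<in>{p \<in> P34. sum_list p = N}. (-1 :: int)^length p) =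
    (-1)^floor_sqrt (N - 1) - (-1)^(N - 1)"
proof -
  have "(\<Sum>p\<in>{p \<in> P34. sum_list p = N}. (-1 :: int)^length p) =
      (\<Sum>m | m < N \<and> odd m. - fps_nth (fps_X^(2*m+1) * odd_gf m) N)"
    unfolding P34_decomp
  proof (subst sum.UNION_disjoint)
    show "\<forall>m\<in>{m. m < N \<and> odd m}. finite {p @ [2*m+1] |p. p @ [2*m+1] \<in> admissible (2*m+1) N}"
      by (auto intro: finite_subset[OF _ finite_admissible])
  qed (auto simp: sum_append_smallest odd_gf_def simp del: power_Suc)
  \<comment> \<open>The factor (-1)^m - 1 is -2 for odd m and 0 for even m, so it selects odd m;
    doubling avoids halves in the integers.\<close>
  also have "2 * \<dots> = (\<Sum>m<N. fps_nth (fps_X * ((- (fps_X^(2*1)))^m * odd_gf m - fps_X^(2*m) * odd_gf m)) N)"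
    unfolding sum_distrib_left
  proof (rule sum.mono_neutral_cong_left)
    show "\<forall>m\<in>{..<N} - {m. m < N \<and> odd m}.
        fps_nth (fps_X * ((- (fps_X^(2*1)))^m * odd_gf m - fps_X^(2*m) * odd_gf m)) N = 0"
      by (auto simp: power_mult)
    show "2 * - fps_nth (fps_X^(2*m+1) * odd_gf m) N =
        fps_nth (fps_X * ((- (fps_X^(2*1)))^m * odd_gf m - fps_X^(2*m) * odd_gf m)) N"
      if "m \<in> {m. m < N \<and> odd m}" for m
    proof -
      have "fps_X * ((- (fps_X^(2*1)))^m * odd_gf m - fps_X^(2*m) * odd_gf m) =
          - (fps_X^(2*m+1) * odd_gf m) - fps_X^(2*m+1) * odd_gf m"
        using that by (simp add: power_mult right_diff_distrib mult.assoc)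
      then show ?thesis by (simp only: fps_sub_nth fps_neg_nth)
    qed
  qed auto
  also have "\<dots> = fps_nth (fps_X * (alt_sum N 1 - (\<Sum>m<N. fps_X^(2*m) * odd_gf m))) N"
    by (simp add: alt_sum_def sum_subtractf fps_sum_nth)
  \<comment> \<open>The factor q moves the coefficient to N - 1, just below the truncation order
    N.\<close>
  also have "\<dots> = (-1)^floor_sqrt (N - 1) - (-1)^(N - 1)"
    using assms alt_sum_1_nth[of "N - 1" N] sum_odd_gf_nth[of "N - 1" N] by simp
  finally show ?thesis .
qed

section \<open>From the parity of the square root to intervals between squares\<close>

lemma floor_sqrt_eqI:
  fixes t :: int
  assumes "0 \<le> t" "t^2 < int N" "int N < (t + 1)^2"
  shows "int (floor_sqrt (N - 1)) = t"
proof -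
  obtain r where r: "t = int r" using assms(1) nonneg_int_cases by blast
  have "int (r^2) < int N" "int N < int ((Suc r)^2)"
    using assms by (simp_all add: r ac_simps)
  then have "floor_sqrt (N - 1) = r"
    by (intro floor_sqrt_unique) linarith+
  then show ?thesis by (simp add: r)
qed

text \<open>With r the root of N - 1, only N = (r + 1)^2 could violate the strict upper bound, and
  then N and r would have opposite parity.\<close>

lemma floor_sqrt_bounds:
  assumes "N \<ge> 1" "even (N + floor_sqrt (N - 1))"
  shows "(int (floor_sqrt (N - 1)))^2 < int N \<and> int N < (int (floor_sqrt (N - 1)) + 1)^2"
proof -
  define r where "r = floor_sqrt (N - 1)"
  have "r^2 \<le> N - 1" "N - 1 < (Suc r)^2"
    unfolding r_def by (simp_all add: Suc_floor_sqrt_power2_gt)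
  moreover have "N \<noteq> (Suc r)^2"
    using assms(2) unfolding r_def [symmetric] by auto
  ultimately have "int (r^2) < int N" "int N < int ((Suc r)^2)"
    using assms(1) by linarith+
  then show ?thesis unfolding r_def [symmetric] by (simp add: ac_simps)
qed

theorem theorem5p6:
  fixes N :: nat
  assumes "N \<ge> 1"
  shows "(\<Sum>p \<in> {p \<in> P34. weight p = N}. (- 1 :: int) ^ num_parts p) =
    (if even N \<and> (\<exists>j::int. j \<ge> 1 \<and> (2 * j)^2 < int N \<and> int N < (2 * j + 1)^2) then 1
     else if odd N \<and> (\<exists>j::int. j \<ge> 1 \<and> (2 * j - 1)^2 < int N \<and> int N < (2 * j)^2) then - 1
     else 0)"
proof -
  define r where "r = floor_sqrt (N - 1)"
  have even_iff: "(\<exists>j::int. j \<ge> 1 \<and> (2 * j)^2 < int N \<and> int N < (2 * j + 1)^2) \<longleftrightarrow> even r"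
    if "even N"
  proof
    assume "\<exists>j::int. j \<ge> 1 \<and> (2 * j)^2 < int N \<and> int N < (2 * j + 1)^2"
    then obtain j :: int where "int r = 2 * j"
      unfolding r_def using floor_sqrt_eqI[of "2 * _" N] by force
    then show "even r" by presburger
  next
    assume "even r"
    then obtain i where i: "r = 2 * i" by blast
    have "(2 * int i)^2 < int N \<and> int N < (2 * int i + 1)^2"
      using floor_sqrt_bounds[OF assms, folded r_def] that i by simp
    \<comment> \<open>For i = 0 the bounds would read 0 < N < 1.\<close>
    moreover from this that have "i \<noteq> 0" by (cases "i = 0") auto
    ultimately show "\<exists>j::int. j \<ge> 1 \<and> (2 * j)^2 < int N \<and> int N < (2 * j + 1)^2"
      by (intro exI[of _ "int i"]) auto
  qed
  have odd_iff: "(\<exists>j::int. j \<ge> 1 \<and> (2 * j - 1)^2 < int N \<and> int N < (2 * j)^2) \<longleftrightarrow> odd r"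
    if "odd N"
  proof
    assume "\<exists>j::int. j \<ge> 1 \<and> (2 * j - 1)^2 < int N \<and> int N < (2 * j)^2"
    then obtain j :: int where "int r = 2 * j - 1"
      unfolding r_def using floor_sqrt_eqI[of "2 * _ - 1" N] by force
    then show "odd r" by presburger
  next
    assume "odd r"
    then obtain i where i: "r = 2 * i + 1" by (blast elim: oddE)
    have "(2 * int (Suc i) - 1)^2 < int N \<and> int N < (2 * int (Suc i))^2"
      using floor_sqrt_bounds[OF assms, folded r_def] that i by (simp add: algebra_simps)
    then show "\<exists>j::int. j \<ge> 1 \<and> (2 * j - 1)^2 < int N \<and> int N < (2 * j)^2"
      by (intro exI[of _ "int (Suc i)"]) auto
  qed
  \<comment> \<open>The right-hand side is 2 or -2 when r and N are both even or both odd, and 0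
    when their parities differ.\<close>
  have "2 * (\<Sum>p \<in> {p \<in> P34. weight p = N}. (- 1 :: int) ^ num_parts p) = (-1)^r + (-1)^N"
    using P34_sum[OF assms] assms unfolding r_def by (cases N) auto
  then show ?thesis
    using even_iff odd_iff by (cases "even N"; cases "even r") auto
qed

end
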